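(* Let $\Bbbk$ be a field of characteristic zero. Let $(X,\circ,\backslash_\circ,\bullet,/_\bullet)$ be a finite $\mathbb{N}^p$-graded involutive birack satisfying Condition lri, and let $\phi=\{\phi_s \mid s=1,\dots,p\}$ be a sequence of pairwise commuting graded automorphisms of $(X,\circ,\backslash_\circ,\bullet,/_\bullet)$ such that $\mathcal{L}_{\phi_s(x)}=\mathcal{L}_x$ for every $1\le s\le p$ and every $x\in X$. Let $A=A(X,\mathbf{R}^\circ)$ be the $\mathbb{N}^p$-graded $\Bbbk$-algebra determined by $(X,\circ,\backslash_\circ,\bullet,/_\bullet)$, and denote again by $\phi_s$ the $\mathbb{N}^p$-graded algebra automorphism of $A$ induced by $\phi_s$. Let $(X,*,\backslash_*,\diamond,/_\diamond)$ be the $\phi$-isotope of $(X,\circ,\backslash_\circ,\bullet,/_\bullet)$ (again an $\mathbb{N}^p$-graded involutive birack) and let $A^*=A^*(X,\mathbf{R}^* )$ be the $\Bbbk$-algebra it determines. Then $A^*$ is isomorphic, as a $\Bbbk$-algebra, to the Zhang twist $A^\phi$ of $A$ by $\phi$.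
   Context: A left quasigroup $(X,\circ,\backslash_\circ)$ is a set with two binary operations satisfying $x\circ(x\backslash_\circ y)=y=x\backslash_\circ(x\circ y)$ for all $x,y$; the left translation $\mathcal{L}_x(a)=x\circ a$ is then bijective with $\mathcal{L}_x^{-1}(a)=x\backslash_\circ a$. A right quasigroup $(X,\bullet,/_\bullet)$ satisfies $(y/_\bullet x)\bullet x=y=(y\bullet x)/_\bullet x$; the right translation $\mathcal{R}_x(a)=a\bullet x$ is bijective with inverse $a\mapsto a/_\bullet x$. A birack $(X,\circ,\backslash_\circ,\bullet,/_\bullet)$ is a left quasigroup $(X,\circ,\backslash_\circ)$ together with a right quasigroup $(X,\bullet,/_\bullet)$ such that for all $x,y,z\in X$: $x\circ(y\circ z)=(x\circ y)\circ((x\bullet y)\circ z)$, $(x\circ y)\bullet((x\bullet y)\circ z)=(x\bullet(y\circ z))\circ(y\bullet z)$, $(x\bullet y)\bullet z=(x\bullet(y\circ z))\bullet(y\bullet z)$. It is involutive if also $(x\circ y)\circ(x\bullet y)=x$ and $(x\circ y)\bullet(x\bullet y)=y$ for all $x,y$. It satisfies Condition lri if $(x\circ y)\bullet x=y=x\circ(y\bullet x)$ for all $x,y$, i.e. $\mathcal{R}_x=\mathcal{L}_x^{-1}$ for all $x$. A birack is $\mathbb{N}^p$-graded if there is a partition $X=X_1\cup\dots\cup X_p$ such that for all $x\in X$ and $y\in X_i$ one has $x\circ y\in X_i$ and $y\bullet x\in X_i$. For $x\in X_i$ the degree $|x|=\deg(x)\in\mathbb{N}^p$ is the $i$-th standard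 unit vector. A graded automorphism of the birack is a bijection $f:X\to X$ with $f(x\circ y)=f(x)\circ f(y)$ and $f(x\bullet y)=f(x)\bullet f(y)$ for all $x,y$, and $f(X_i)\subseteq X_i$ for all $i$. For $\alpha=(a_1,\dots,a_p)$ put $\phi^\alpha=\phi_1^{a_1}\cdots\phi_p^{a_p}$. The $\phi$-isotope $(X,*,\backslash_*,\diamond,/_\diamond)$ is given by $x*y=x\circ\phi^{|x|}(y)$, $x\backslash_* y=\phi^{-|x|}(x\backslash_\circ y)$, $x\diamond y=(x*y)\backslash_* x$, and $x/_\diamond y$ is the image of $x$ under the inverse of the map $a\mapsto a\diamond y$. Under the hypotheses of the theorem it is an $\mathbb{N}^p$-graded involutive birack (with the same partition) satisfying Condition lri. The algebra determined by an involutive birack $(X,\circ,\backslash_\circ,\bullet,/_\bullet)$ is $A(X,\mathbf{R}^\circ)$, the associative unital $\Bbbk$-algebra generated by $X$ subject to the relations $xy=(x\circ y)(x\bullet y)$ for all $x,y\in X$; if the birack is $\mathbb{N}^p$-graded, this algebra is $\mathbb{N}^p$-graded by giving each generator $x$ the degree $|x|$. Likewise $A^*(X,\mathbf{R}^* )$ is generated by $X$ with relations $xy=(x*y)(x\diamond y)$. For an $\mathbb{N}^p$-graded algebra $B$ and a sequence $\phi=\{\phi_s\mid s=1,\dots,p\}$ of commuting $\mathbb{N}^p$-graded algebra automorphisms of $B$, the Zhang twist $B^\phi$ is $B$ as an $\mathbb{N}^p$-graded vector space, with new multiplication determined by $a\star b=a\,\phi^{|a|}(b)$ for $a$ homogeneous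 of degree $|a|=(a_1,\dots,a_p)$, where $\phi^{|a|}=\phi_1^{a_1}\cdots\phi_p^{a_p}$. *)

theory Defs
  imports
    Complex_Main
    "HOL-Library.Disjoint_Sets"
    "HOL-Library.Poly_Mapping"
    "HOL-Algebra.Module"
    "HOL-Algebra.QuotRing"
begin

section \<open>Biracks\<close>

text \<open>
  The underlying set of a birack is the whole type \<open>'x\<close>. For the operations of a birack \<open>X\<close>:
  \<open>x \<rhd>\<^bsub>X\<^esub> y\<close> is $x \circ y$, \<open>x \<bullet>\<^bsub>X\<^esub> y\<close> is $x \bullet y$,
  \<open>ldiv X x y\<close> is $x \backslash_\circ y$, and \<open>rdiv X y x\<close> is $y /_\bullet x$.
\<close>

record 'x birack_ops =
  circ :: "'x \<Rightarrow> 'x \<Rightarrow> 'x" (infixl \<open>\<rhd>\<index>\<close> 70)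
  ldiv :: "'x \<Rightarrow> 'x \<Rightarrow> 'x"
  bul :: "'x \<Rightarrow> 'x \<Rightarrow> 'x" (infixl \<open>\<bullet>\<index>\<close> 70)
  rdiv :: "'x \<Rightarrow> 'x \<Rightarrow> 'x"

definition left_quasigroup :: "('x \<Rightarrow> 'x \<Rightarrow> 'x) \<Rightarrow> ('x \<Rightarrow> 'x \<Rightarrow> 'x) \<Rightarrow> bool" where
  "left_quasigroup f l \<longleftrightarrow> (\<forall>x y. f x (l x y) = y \<and> l x (f x y) = y)"

definition right_quasigroup :: "('x \<Rightarrow> 'x \<Rightarrow> 'x) \<Rightarrow> ('x \<Rightarrow> 'x \<Rightarrow> 'x) \<Rightarrow> bool" where
  "right_quasigroup g r \<longleftrightarrow> (\<forall>x y. g (r y x) x = y \<and> r (g y x) x = y)"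

definition left_translation :: "'x birack_ops \<Rightarrow> 'x \<Rightarrow> 'x \<Rightarrow> 'x" where
  "left_translation X x = (\<lambda>a. x \<rhd>\<^bsub>X\<^esub> a)"

locale birack =
  fixes X :: "'x birack_ops" (structure)
  assumes left_quasi: "left_quasigroup (circ X) (ldiv X)"
    and right_quasi: "right_quasigroup (bul X) (rdiv X)"
    and circ_circ: "x \<rhd> (y \<rhd> z) = (x \<rhd> y) \<rhd> ((x \<bullet> y) \<rhd> z)"
    and circ_bul: "(x \<rhd> y) \<bullet> ((x \<bullet> y) \<rhd> z) = (x \<bullet> (y \<rhd> z)) \<rhd> (y \<bullet> z)"
    and bul_bul: "(x \<bullet> y) \<bullet> z = (x \<bullet> (y \<rhd> z)) \<bullet> (y \<bullet> z)"

locale involutive_birack = birack +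
  assumes invol_circ: "(x \<rhd> y) \<rhd> (x \<bullet> y) = x"
    and invol_bul: "(x \<rhd> y) \<bullet> (x \<bullet> y) = y"

definition condition_lri :: "'x birack_ops \<Rightarrow> bool" where
  "condition_lri X \<longleftrightarrow>
     (\<forall>x y. (x \<rhd>\<^bsub>X\<^esub> y) \<bullet>\<^bsub>X\<^esub> x = y \<and> x \<rhd>\<^bsub>X\<^esub> (y \<bullet>\<^bsub>X\<^esub> x) = y)"

text \<open>The parts of a grading are \<open>P 1, \<dots>, P p\<close>; the values of \<open>P\<close> elsewhere are irrelevant.\<close>

definition graded_birack :: "nat \<Rightarrow> (nat \<Rightarrow> 'x set) \<Rightarrow> 'x birack_ops \<Rightarrow> bool" where
  "graded_birack p P X \<longleftrightarrow>
     (\<Union>i\<in>{1..p}. P i) = UNIV \<and> disjoint_family_on P {1..p} \<and>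
     (\<forall>i\<in>{1..p}. \<forall>x. \<forall>y\<in>P i. x \<rhd>\<^bsub>X\<^esub> y \<in> P i \<and> y \<bullet>\<^bsub>X\<^esub> x \<in> P i)"

definition graded_birack_automorphism ::
    "nat \<Rightarrow> (nat \<Rightarrow> 'x set) \<Rightarrow> 'x birack_ops \<Rightarrow> ('x \<Rightarrow> 'x) \<Rightarrow> bool" where
  "graded_birack_automorphism p P X f \<longleftrightarrow>
     bij f \<and>
     (\<forall>x y. f (x \<rhd>\<^bsub>X\<^esub> y) = f x \<rhd>\<^bsub>X\<^esub> f y) \<and>
     (\<forall>x y. f (x \<bullet>\<^bsub>X\<^esub> y) = f x \<bullet>\<^bsub>X\<^esub> f y) \<and>
     (\<forall>i\<in>{1..p}. f ` P i \<subseteq> P i)"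


section \<open>Multidegrees and isotopes\<close>

text \<open>
  Elements of $\mathbb{N}^p$ are functions \<open>nat \<Rightarrow> nat\<close> vanishing outside \<open>{1..p}\<close>.
\<close>

type_synonym multidegree = "nat \<Rightarrow> nat"

definition multidegrees :: "nat \<Rightarrow> multidegree set" where
  "multidegrees p = {d. \<forall>i. i \<notin> {1..p} \<longrightarrow> d i = 0}"

definition degree_of :: "nat \<Rightarrow> (nat \<Rightarrow> 'x set) \<Rightarrow> 'x \<Rightarrow> multidegree" where
  "degree_of p P x = (\<lambda>j. if j = (THE i. i \<in> {1..p} \<and> x \<in> P i) then 1 else 0)"

text \<open>$\phi^\alpha = \phi_1^{a_1} \circ \dots \circ \phi_p^{a_p}$\<close>

definition multi_power :: "nat \<Rightarrow> (nat \<Rightarrow> 'a \<Rightarrow> 'a) \<Rightarrow> multidegree \<Rightarrow> 'a \<Rightarrow> 'a" where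
  "multi_power p \<phi> \<alpha> = foldr (\<lambda>s g. (\<phi> s ^^ \<alpha> s) \<circ> g) [1..<Suc p] id"

definition isotope_circ ::
    "nat \<Rightarrow> (nat \<Rightarrow> 'x set) \<Rightarrow> (nat \<Rightarrow> 'x \<Rightarrow> 'x) \<Rightarrow> 'x birack_ops \<Rightarrow> 'x \<Rightarrow> 'x \<Rightarrow> 'x" where
  "isotope_circ p P \<phi> X x y = x \<rhd>\<^bsub>X\<^esub> multi_power p \<phi> (degree_of p P x) y"

definition isotope_ldiv ::
    "nat \<Rightarrow> (nat \<Rightarrow> 'x set) \<Rightarrow> (nat \<Rightarrow> 'x \<Rightarrow> 'x) \<Rightarrow> 'x birack_ops \<Rightarrow> 'x \<Rightarrow> 'x \<Rightarrow> 'x" where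
  "isotope_ldiv p P \<phi> X x y = inv_into UNIV (multi_power p \<phi> (degree_of p P x)) (ldiv X x y)"

definition isotope_bul ::
    "nat \<Rightarrow> (nat \<Rightarrow> 'x set) \<Rightarrow> (nat \<Rightarrow> 'x \<Rightarrow> 'x) \<Rightarrow> 'x birack_ops \<Rightarrow> 'x \<Rightarrow> 'x \<Rightarrow> 'x" where
  "isotope_bul p P \<phi> X x y = isotope_ldiv p P \<phi> X (isotope_circ p P \<phi> X x y) x"

definition isotope_rdiv ::
    "nat \<Rightarrow> (nat \<Rightarrow> 'x set) \<Rightarrow> (nat \<Rightarrow> 'x \<Rightarrow> 'x) \<Rightarrow> 'x birack_ops \<Rightarrow> 'x \<Rightarrow> 'x \<Rightarrow> 'x" where
  "isotope_rdiv p P \<phi> X x y = inv_into UNIV (\<lambda>a. isotope_bul p P \<phi> X a y) x"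

definition isotope ::
    "nat \<Rightarrow> (nat \<Rightarrow> 'x set) \<Rightarrow> (nat \<Rightarrow> 'x \<Rightarrow> 'x) \<Rightarrow> 'x birack_ops \<Rightarrow> 'x birack_ops" where
  "isotope p P \<phi> X =
     \<lparr>circ = isotope_circ p P \<phi> X, ldiv = isotope_ldiv p P \<phi> X,
      bul = isotope_bul p P \<phi> X, rdiv = isotope_rdiv p P \<phi> X\<rparr>"


section \<open>Free algebras and their quotients\<close>

text \<open>
  The free monoid on \<open>'x\<close>, written additively so that finitely supported functions on it carry the
  convolution product of \<^theory>\<open>HOL-Library.Poly_Mapping\<close>; \<open>'x word \<Rightarrow>\<^sub>0 'k\<close> is then the free
  associative unital algebra on \<open>'x\<close>.
\<close>

datatype 'x word = Word (letters: "'x list")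

instantiation word :: (type) monoid_add
begin

definition zero_word :: "'x word" where
  "zero_word = Word []"

definition plus_word :: "'x word \<Rightarrow> 'x word \<Rightarrow> 'x word" where
  "plus_word v w = Word (letters v @ letters w)"

instance
  by standard (simp_all add: zero_word_def plus_word_def)

end

text \<open>
  Algebras over the field \<open>'k\<close> are records of type \<^typ>\<open>('k, 'a) module\<close>, whose ring part need not
  be commutative.
\<close>

definition free_algebra :: "('k::field, 'x word \<Rightarrow>\<^sub>0 'k) module" where
  "free_algebra =
     \<lparr>carrier = UNIV, mult = (*), one = 1, zero = 0, add = (+),
      smult = (\<lambda>c f. Poly_Mapping.single 0 c * f)\<rparr>"

definition gen :: "'x \<Rightarrow> 'x word \<Rightarrow>\<^sub>0 'k::field" where
  "gen x = Poly_Mapping.single (Word [x]) 1"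

text \<open>
  The map on cosets of \<open>I\<close> induced by a self-map \<open>h\<close> of the algebra, in the style of
  \<^const>\<open>rcoset_mult\<close>: if \<open>h\<close> is additive and maps \<open>I\<close> into \<open>I\<close>, it sends
  \<open>I +> f\<close> to \<open>I +> h f\<close>.
\<close>

definition induced_map :: "('a, 'b) ring_scheme \<Rightarrow> 'a set \<Rightarrow> ('a \<Rightarrow> 'a) \<Rightarrow> 'a set \<Rightarrow> 'a set" where
  "induced_map B I h C = (\<Union>f\<in>C. I +>\<^bsub>B\<^esub> h f)"

definition quotient_algebra :: "('k, 'a) module \<Rightarrow> 'a set \<Rightarrow> ('k, 'a set) module" where
  "quotient_algebra B I =
     \<lparr>carrier = carrier (B Quot I), mult = mult (B Quot I), one = one (B Quot I),
      zero = zero (B Quot I), add = add (B Quot I),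
      smult = (\<lambda>c. induced_map B I (\<lambda>f. c \<odot>\<^bsub>B\<^esub> f))\<rparr>"

text \<open>
  For a ring, \<^const>\<open>ideal\<close> means two-sided ideal, also in the noncommutative case; since
  the free algebra is unital, ideals are closed under scalar multiplication.
\<close>

definition relation_ideal :: "'x birack_ops \<Rightarrow> ('x word \<Rightarrow>\<^sub>0 'k::field) set" where
  "relation_ideal X =
     genideal (free_algebra :: ('k, 'x word \<Rightarrow>\<^sub>0 'k) module)
       {gen x * gen y - gen (x \<rhd>\<^bsub>X\<^esub> y) * gen (x \<bullet>\<^bsub>X\<^esub> y) | x y. True}"

definition birack_algebra :: "'x birack_ops \<Rightarrow> ('k::field, ('x word \<Rightarrow>\<^sub>0 'k) set) module" where
  "birack_algebra X = quotient_algebra free_algebra (relation_ideal X)"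


section \<open>Grading and induced automorphisms of the algebra of a birack\<close>

definition word_degree :: "nat \<Rightarrow> (nat \<Rightarrow> 'x set) \<Rightarrow> 'x word \<Rightarrow> multidegree" where
  "word_degree p P w = (\<lambda>i. \<Sum>x\<leftarrow>letters w. degree_of p P x i)"

text \<open>The homogeneous part of degree \<open>d\<close>: classes of combinations of words of degree \<open>d\<close>.\<close>

definition birack_algebra_grading ::
    "nat \<Rightarrow> (nat \<Rightarrow> 'x set) \<Rightarrow> 'x birack_ops \<Rightarrow> multidegree \<Rightarrow> ('x word \<Rightarrow>\<^sub>0 'k::field) set set" where
  "birack_algebra_grading p P X d =
     {relation_ideal X +>\<^bsub>(free_algebra :: ('k, 'x word \<Rightarrow>\<^sub>0 'k) module)\<^esub> f | f.
        \<forall>w\<in>Poly_Mapping.keys f. word_degree p P w = d}"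

definition free_algebra_map :: "('x \<Rightarrow> 'x) \<Rightarrow> ('x word \<Rightarrow>\<^sub>0 'k::field) \<Rightarrow> 'x word \<Rightarrow>\<^sub>0 'k" where
  "free_algebra_map h f =
     (\<Sum>w\<in>Poly_Mapping.keys f. Poly_Mapping.single (map_word h w) (Poly_Mapping.lookup f w))"

definition birack_algebra_map ::
    "'x birack_ops \<Rightarrow> ('x \<Rightarrow> 'x) \<Rightarrow> ('x word \<Rightarrow>\<^sub>0 'k::field) set \<Rightarrow> ('x word \<Rightarrow>\<^sub>0 'k) set" where
  "birack_algebra_map X h =
     induced_map (free_algebra :: ('k, 'x word \<Rightarrow>\<^sub>0 'k) module) (relation_ideal X)
       (free_algebra_map h)"


section \<open>Zhang twists\<close>

text \<open>
  \<open>G d\<close> is the homogeneous part of degree \<open>d\<close> of the graded algebra \<open>B\<close>;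
  \<open>homogeneous_components p B G a\<close> is the family of components of \<open>a\<close>, unique because
  \<open>B\<close> is the direct sum of the \<open>G d\<close>.
\<close>

definition homogeneous_components ::
    "nat \<Rightarrow> ('k, 'a) module \<Rightarrow> (multidegree \<Rightarrow> 'a set) \<Rightarrow> 'a \<Rightarrow> multidegree \<Rightarrow> 'a" where
  "homogeneous_components p B G a =
     (THE c. (\<forall>d\<in>multidegrees p. c d \<in> G d) \<and> (\<forall>d. d \<notin> multidegrees p \<longrightarrow> c d = \<zero>\<^bsub>B\<^esub>) \<and>
        finite {d. c d \<noteq> \<zero>\<^bsub>B\<^esub>} \<and> a = (\<Oplus>\<^bsub>B\<^esub>d\<in>{d. c d \<noteq> \<zero>\<^bsub>B\<^esub>}. c d))"

text \<open>The additive extension of $a \star b = a\,\phi^{|a|}(b)$ from homogeneous \<open>a\<close> to all \<open>a\<close>.\<close>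

definition zhang_mult ::
    "nat \<Rightarrow> ('k, 'a) module \<Rightarrow> (multidegree \<Rightarrow> 'a set) \<Rightarrow> (nat \<Rightarrow> 'a \<Rightarrow> 'a) \<Rightarrow> 'a \<Rightarrow> 'a \<Rightarrow> 'a" where
  "zhang_mult p B G \<phi> a b =
     (let c = homogeneous_components p B G a
      in \<Oplus>\<^bsub>B\<^esub>d\<in>{d. c d \<noteq> \<zero>\<^bsub>B\<^esub>}. c d \<otimes>\<^bsub>B\<^esub> multi_power p \<phi> d b)"

definition zhang_twist ::
    "nat \<Rightarrow> ('k, 'a) module \<Rightarrow> (multidegree \<Rightarrow> 'a set) \<Rightarrow> (nat \<Rightarrow> 'a \<Rightarrow> 'a) \<Rightarrow> ('k, 'a) module" where
  "zhang_twist p B G \<phi> = B\<lparr>mult := zhang_mult p B G \<phi>\<rparr>"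


section \<open>Isomorphism of algebras\<close>

definition algebra_isomorphic :: "('k, 'a) module \<Rightarrow> ('k, 'b) module \<Rightarrow> bool" where
  "algebra_isomorphic B C \<longleftrightarrow>
     (\<exists>h\<in>ring_iso B C. \<forall>c. \<forall>a\<in>carrier B. h (c \<odot>\<^bsub>B\<^esub> a) = c \<odot>\<^bsub>C\<^esub> h a)"

end

theory Submission
  imports Defs
begin

text \<open>
  On words put $T(x_1 x_2 \cdots x_n) = x_1\, \phi^{|x_1|}(x_2)\, \phi^{|x_1| + |x_2|}(x_3) \cdots$.
  Since the $\phi_s$ commute and preserve degrees, $T(uv) = T(u)\, \phi^{|u|}(T(v))$, so the linear
  extension of $T$ is an isomorphism from the free algebra onto its own Zhang twist. With
  $y' = \phi^{|x|}(y)$ involutivity gives $\phi^{|x * y|}(x \diamond y) = x \bullet y'$, hence $T$ maps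
  the relation $xy - (x * y)(x \diamond y)$ to $xy' - (x \circ y')(x \bullet y')$. As the ideals of
  relations are spanned by the multiples of the relations by words, and $T$ is bijective on these
  multiples, $T$ maps one ideal onto the other and descends to the quotients.
\<close>

section \<open>Linear extension on monoid algebras\<close>

text \<open>The same term as the scalar multiplication of \<open>free_algebra\<close>, so that
  linear spans and ideals can be compared directly.\<close>

abbreviation scale :: "'k::field \<Rightarrow> ('a::monoid_add \<Rightarrow>\<^sub>0 'k) \<Rightarrow> 'a \<Rightarrow>\<^sub>0 'k" where
  "scale c f \<equiv> Poly_Mapping.single 0 c * f"

global_interpretation monoid_algebra: Vector_Spaces.vector_space scale
  by unfold_locales
    (simp_all add: distrib_left distrib_right single_add mult_single flip: mult.assoc)

text \<open>Every finitely supported function is the sum of its monomials. Zero has no case of its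
  own, being a monomial with coefficient zero.\<close>

lemma monoid_algebra_induct [case_names single add]:
  fixes f :: "'a \<Rightarrow>\<^sub>0 'k::comm_monoid_add"
  assumes single: "\<And>w c. Q (Poly_Mapping.single w c)"
    and add: "\<And>f g. Q f \<Longrightarrow> Q g \<Longrightarrow> Q (f + g)"
  shows "Q f"
proof -
  have "Q (\<Sum>w\<in>A. Poly_Mapping.single w (Poly_Mapping.lookup f w))" if "finite A" for A
    using that
  proof induction
    case empty
    show ?case using single[of undefined 0] by simp
  qed (simp add: assms)
  moreover have "(\<Sum>w\<in>Poly_Mapping.keys f. Poly_Mapping.single w (Poly_Mapping.lookup f w)) = f"
    by (rule poly_mapping_eqI)
      (simp add: lookup_sum lookup_single when_def in_keys_iff)
  ultimately show ?thesis
    by (metis finite_keys)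
qed

definition linear_extension ::
    "('a \<Rightarrow> 'b::monoid_add \<Rightarrow>\<^sub>0 'k::field) \<Rightarrow> ('a \<Rightarrow>\<^sub>0 'k) \<Rightarrow> 'b \<Rightarrow>\<^sub>0 'k" where
  "linear_extension g f = (\<Sum>w\<in>Poly_Mapping.keys f. scale (Poly_Mapping.lookup f w) (g w))"

text \<open>Words outside the support have coefficient zero. A common index set is what additivity
  requires, because cancellation may shrink the support of a sum.\<close>

lemma linear_extension_superset:
  assumes "finite A" "Poly_Mapping.keys f \<subseteq> A"
  shows "linear_extension g f = (\<Sum>w\<in>A. scale (Poly_Mapping.lookup f w) (g w))"
  unfolding linear_extension_def
  by (rule sum.mono_neutral_left) (use assms in \<open>auto simp: in_keys_iff\<close>)

lemma linear_extension_add: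
  "linear_extension g (f + f') = linear_extension g f + linear_extension g f'"
proof -
  let ?A = "Poly_Mapping.keys f \<union> Poly_Mapping.keys f'"
  have "linear_extension g h = (\<Sum>w\<in>?A. scale (Poly_Mapping.lookup h w) (g w))"
    if "Poly_Mapping.keys h \<subseteq> ?A" for h
    using that by (rule linear_extension_superset[rotated]) simp
  then show ?thesis
    by (simp add: keys_add lookup_add single_add distrib_right sum.distrib)
qed

lemma linear_extension_single [simp]:
  "linear_extension g (Poly_Mapping.single w c) = scale c (g w)"
  by (simp add: linear_extension_def)

lemma linear_extension_scale:
  fixes f :: "'a::monoid_add \<Rightarrow>\<^sub>0 'k::field"
  shows "linear_extension g (scale c f) = scale c (linear_extension g f)"
  by (induction f rule: monoid_algebra_induct)
    (simp_all add: mult_single distrib_left linear_extension_add flip: mult.assoc)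

text \<open>Makes available that linear maps carry spans to spans, which is how ideals are
  transported below.\<close>

lemma module_hom_linear_extension:
  fixes g :: "'a::monoid_add \<Rightarrow> 'b::monoid_add \<Rightarrow>\<^sub>0 'k::field"
  shows "module_hom scale scale (linear_extension g)"
  by unfold_locales (simp_all add: linear_extension_add linear_extension_scale)

lemma linear_extension_diff:
  fixes f :: "'a::monoid_add \<Rightarrow>\<^sub>0 'k::field"
  shows "linear_extension g (f - f') = linear_extension g f - linear_extension g f'"
  by (rule module_hom.diff[OF module_hom_linear_extension])

text \<open>The linear map with prescribed action on the basis of words. It need not be
  multiplicative: \<open>t\<close> may be the twist of words, which in general is no monoid
  homomorphism.\<close>

abbreviation extend_map :: "('a \<Rightarrow> 'b::monoid_add) \<Rightarrow> ('a \<Rightarrow>\<^sub>0 'k::field) \<Rightarrow> 'b \<Rightarrow>\<^sub>0 'k" where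
  "extend_map t \<equiv> linear_extension (\<lambda>w. Poly_Mapping.single (t w) 1)"

lemma extend_map_single [simp]:
  "extend_map t (Poly_Mapping.single w c) = Poly_Mapping.single (t w) c"
  by (simp add: mult_single)

lemma extend_map_id: "extend_map (\<lambda>w. w) f = f"
  by (induction f rule: monoid_algebra_induct) (simp_all add: linear_extension_add mult_single)

lemma extend_map_comp: "extend_map s (extend_map t f) = extend_map (s \<circ> t) f"
  by (induction f rule: monoid_algebra_induct) (simp_all add: linear_extension_add mult_single)

section \<open>Functoriality of the algebra maps induced by maps of letters\<close>

lemma free_algebra_map_eq: "free_algebra_map h = extend_map (map_word h)"
  by (rule ext) (simp add: free_algebra_map_def linear_extension_def mult_single)

lemma free_algebra_map_add:
  "free_algebra_map h (f + f') = free_algebra_map h f + free_algebra_map h f'"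
  by (simp add: free_algebra_map_eq linear_extension_add)

lemma free_algebra_map_id: "free_algebra_map id f = f"
  by (simp add: free_algebra_map_eq word.map_id0 extend_map_id)

lemma free_algebra_map_comp:
  "free_algebra_map (h \<circ> k) f = free_algebra_map h (free_algebra_map k f)"
proof -
  have "map_word (h \<circ> k) = map_word h \<circ> map_word k"
    by (simp add: fun_eq_iff word.map_comp)
  then show ?thesis
    by (simp add: free_algebra_map_eq extend_map_comp)
qed


section \<open>Quotients of the free algebra\<close>

lemma ring_free_algebra: "ring free_algebra"
proof (rule ringI)
  show "abelian_group free_algebra"
    by (rule abelian_groupI) (auto simp: free_algebra_def add.assoc add.commute intro: exI[of _ "- _"])
  show "Group.monoid free_algebra"
    by (rule monoidI) (simp_all add: free_algebra_def mult.assoc)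
qed (simp_all add: free_algebra_def distrib_left distrib_right)

text \<open>Closure under negatives comes from multiplication by -1.\<close>

lemma ideal_free_algebraI:
  fixes I :: "('x word \<Rightarrow>\<^sub>0 'k::field) set"
  assumes "0 \<in> I" "\<And>f g. f \<in> I \<Longrightarrow> g \<in> I \<Longrightarrow> f + g \<in> I"
    and "\<And>f a. f \<in> I \<Longrightarrow> a * f \<in> I" "\<And>f a. f \<in> I \<Longrightarrow> f * a \<in> I"
  shows "ideal I free_algebra"
proof (rule idealI[OF ring_free_algebra])
  have inv: "inv\<^bsub>add_monoid free_algebra\<^esub> f = - f" for f :: "'x word \<Rightarrow>\<^sub>0 'k"
    using abelian_group.minus_equality[OF ring_free_algebra[THEN ring.is_abelian_group], of "- f" f]
    by (simp add: free_algebra_def a_inv_def)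
  have "- f \<in> I" if "f \<in> I" for f
    using assms(3)[OF that, of "- 1"] by simp
  then show "subgroup I (add_monoid free_algebra)"
    unfolding subgroup_def inv using assms by (simp add: free_algebra_def)
qed (use assms in \<open>simp_all add: free_algebra_def\<close>)

text \<open>Stated for an arbitrary ideal because cosets are needed both for the relations of a
  birack and for those of its isotope.\<close>

locale free_algebra_ideal =
  fixes I :: "('x word \<Rightarrow>\<^sub>0 'k::field) set"
  assumes ideal: "ideal I free_algebra"
begin

abbreviation coset :: "('x word \<Rightarrow>\<^sub>0 'k) \<Rightarrow> ('x word \<Rightarrow>\<^sub>0 'k) set" where
  "coset f \<equiv> I +>\<^bsub>free_algebra\<^esub> f"

lemma coset_def: "coset f = (\<lambda>i. i + f) ` I"
  by (auto simp: a_r_coset_def r_coset_def free_algebra_def)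

lemma zero_mem: "0 \<in> I"
  using additive_subgroup.zero_closed[OF ideal.axioms(1)[OF ideal]] by (simp add: free_algebra_def)

lemma add_mem: "f \<in> I \<Longrightarrow> g \<in> I \<Longrightarrow> f + g \<in> I"
  using additive_subgroup.a_closed[OF ideal.axioms(1)[OF ideal]] by (simp add: free_algebra_def)

lemma mult_mem: "f \<in> I \<Longrightarrow> a * f \<in> I" "f \<in> I \<Longrightarrow> f * a \<in> I"
  using ideal.I_l_closed[OF ideal] ideal.I_r_closed[OF ideal] by (simp_all add: free_algebra_def)

lemma uminus_mem: "f \<in> I \<Longrightarrow> - f \<in> I"
  using mult_mem(1)[of f "- 1"] by simp

lemma coset_eq_iff: "coset f = coset g \<longleftrightarrow> f - g \<in> I"
proof
  assume "coset f = coset g"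
  moreover have "f \<in> coset f"
    unfolding coset_def by (rule image_eqI[OF _ zero_mem]) simp
  ultimately show "f - g \<in> I"
    by (auto simp: coset_def)
next
  have sub: "coset f \<subseteq> coset g" if "f - g \<in> I" for f g
  proof
    fix h assume "h \<in> coset f"
    then obtain i where "i \<in> I" "h = i + f"
      by (auto simp: coset_def)
    then have "i + (f - g) \<in> I" "h = (i + (f - g)) + g"
      using that by (auto intro: add_mem)
    then show "h \<in> coset g"
      unfolding coset_def by blast
  qed
  assume "f - g \<in> I"
  then show "coset f = coset g"
    using sub uminus_mem[of "f - g"] by (metis minus_diff_eq subset_antisym)
qed

lemma coset_zero: "coset 0 = I"
  by (simp add: coset_def)

lemma coset_eq_ideal_iff: "coset f = I \<longleftrightarrow> f \<in> I"
  using coset_eq_iff[of f 0] by (simp add: coset_zero)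

text \<open>Representatives of one coset differ by some \<open>i\<close> in \<open>I\<close>, and
  \<open>h (i + f) = h i + h f\<close> with \<open>h i\<close> in \<open>I\<close>; so all cosets in
  the union that defines \<open>induced_map\<close> coincide.\<close>

lemma induced_map_coset:
  assumes "\<And>f g. h (f + g) = h f + h g" "\<And>f. f \<in> I \<Longrightarrow> h f \<in> I"
  shows "induced_map free_algebra I h (coset f) = coset (h f)"
proof -
  have "coset (h (i + f)) = coset (h f)" if "i \<in> I" for i
    using that assms by (simp add: coset_eq_iff)
  then show ?thesis
    using zero_mem by (auto simp: induced_map_def coset_def[of f])
qed

abbreviation Q :: "('k, ('x word \<Rightarrow>\<^sub>0 'k) set) module" where
  "Q \<equiv> quotient_algebra free_algebra I"

lemma carrier_quotient: "carrier Q = range coset"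
  by (auto simp: quotient_algebra_def FactRing_def A_RCOSETS_def RCOSETS_def a_r_coset_def
      free_algebra_def)

lemma coset_mem_carrier: "coset f \<in> carrier Q"
  by (simp add: carrier_quotient)

lemma zero_quotient: "\<zero>\<^bsub>Q\<^esub> = coset 0"
  by (simp add: quotient_algebra_def FactRing_def coset_zero)

lemma one_quotient: "\<one>\<^bsub>Q\<^esub> = coset 1"
  by (simp add: quotient_algebra_def FactRing_def free_algebra_def)

lemma add_quotient: "coset f \<oplus>\<^bsub>Q\<^esub> coset g = coset (f + g)"
  using abelian_subgroup.a_rcos_sum[OF abelian_subgroupI3, OF ideal.axioms(1)[OF ideal] ring.is_abelian_group[OF ring_free_algebra], of f g] by (simp add: quotient_algebra_def FactRing_def free_algebra_def)

lemma mult_quotient: "coset f \<otimes>\<^bsub>Q\<^esub> coset g = coset (f * g)"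
  using ideal.rcoset_mult_add[OF ideal, of f g] by (simp add: quotient_algebra_def FactRing_def free_algebra_def)

lemma smult_quotient: "c \<odot>\<^bsub>Q\<^esub> coset f = coset (scale c f)"
proof -
  have "induced_map free_algebra I (scale c) (coset f) = coset (scale c f)"
    by (rule induced_map_coset) (simp_all add: distrib_left mult_mem)
  then show ?thesis
    by (simp add: quotient_algebra_def free_algebra_def)
qed

lemma abelian_monoid_quotient: "abelian_monoid Q"
  by (rule abelian_monoidI)
    (auto simp: carrier_quotient add_quotient zero_quotient ac_simps)

lemma finsum_quotient:
  assumes "finite A"
  shows "(\<Oplus>\<^bsub>Q\<^esub>d\<in>A. coset (f d)) = coset (\<Sum>d\<in>A. f d)"
  using assms
proof induction
  case empty
  show ?case
    by (simp add: abelian_monoid.finsum_empty[OF abelian_monoid_quotient] zero_quotient)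
next
  case (insert d A)
  then show ?case
    by (subst abelian_monoid.finsum_insert[OF abelian_monoid_quotient])
      (auto simp: coset_mem_carrier add_quotient)
qed

end


section \<open>The ideal of relations\<close>

text \<open>One application of a defining relation to two adjacent letters of a word, recorded as
  the pair of the words before and after.\<close>

definition moves :: "'x birack_ops \<Rightarrow> ('x word \<times> 'x word) set" where
  "moves X = {(u + Word [x, y] + v, u + Word [x \<rhd>\<^bsub>X\<^esub> y, x \<bullet>\<^bsub>X\<^esub> y] + v) | u v x y. True}"

definition difference :: "'x word \<times> 'x word \<Rightarrow> 'x word \<Rightarrow>\<^sub>0 'k::field" where
  "difference = (\<lambda>(a, b). Poly_Mapping.single a 1 - Poly_Mapping.single b 1)"

lemma gen_mult: "gen x * gen y = Poly_Mapping.single (Word [x, y]) 1"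
  by (simp add: gen_def mult_single plus_word_def)

lemma relation_multiple:
  "Poly_Mapping.single u 1 * (gen x * gen y - gen x' * gen y') * Poly_Mapping.single v 1
   = difference (u + Word [x, y] + v, u + Word [x', y'] + v)"
  by (simp add: gen_mult difference_def left_diff_distrib right_diff_distrib mult_single)

lemma relation_ideal_is_ideal:
  "ideal (relation_ideal X :: ('x word \<Rightarrow>\<^sub>0 'k::field) set) free_algebra"
  unfolding relation_ideal_def
  by (rule ring.genideal_ideal[OF ring_free_algebra]) (simp add: free_algebra_def)

text \<open>Each difference along a move is a multiple of a defining relation by words. Conversely,
  the span of these differences contains the relations and is stable under multiplication by words,
  hence a two-sided ideal. A description by linear combinations alone is wanted because the twist is
  linear but need not be multiplicative.\<close>

lemma relation_ideal_eq_span: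
  "relation_ideal X = monoid_algebra.span (difference ` moves X :: ('x word \<Rightarrow>\<^sub>0 'k::field) set)"
    (is "?I = ?S")
proof
  interpret free_algebra_ideal ?I
    by (rule free_algebra_ideal.intro[OF relation_ideal_is_ideal])
  let ?R = "{gen x * gen y - gen (x \<rhd>\<^bsub>X\<^esub> y) * gen (x \<bullet>\<^bsub>X\<^esub> y) | x y. True}
    :: ('x word \<Rightarrow>\<^sub>0 'k) set"
  have R: "?R \<subseteq> ?I"
    unfolding relation_ideal_def
    by (rule ring.genideal_self[OF ring_free_algebra]) (simp add: free_algebra_def)
  show "?S \<subseteq> ?I"
  proof (rule monoid_algebra.span_minimal)
    show "difference ` moves X \<subseteq> ?I"
    proof clarify
      fix a b assume "(a, b) \<in> moves X"
      then obtain u v x y where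
        "a = u + Word [x, y] + v" "b = u + Word [x \<rhd>\<^bsub>X\<^esub> y, x \<bullet>\<^bsub>X\<^esub> y] + v"
        by (auto simp: moves_def)
      then have "(difference (a, b) :: 'x word \<Rightarrow>\<^sub>0 'k) = Poly_Mapping.single u 1 *
          (gen x * gen y - gen (x \<rhd>\<^bsub>X\<^esub> y) * gen (x \<bullet>\<^bsub>X\<^esub> y)) * Poly_Mapping.single v 1"
        by (simp only: relation_multiple)
      moreover have "gen x * gen y - gen (x \<rhd>\<^bsub>X\<^esub> y) * gen (x \<bullet>\<^bsub>X\<^esub> y) \<in> ?I"
        using R by blast
      ultimately show "difference (a, b) \<in> ?I"
        by (metis mult_mem)
    qed
    show "monoid_algebra.subspace ?I"
      unfolding monoid_algebra.subspace_def using zero_mem add_mem mult_mem by blast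
  qed
  \<comment> \<open>Moves stay moves inside a longer word; this makes the span two-sided.\<close>
  have moves_mult: "(u + a + v, u + b + v) \<in> moves X" if "(a, b) \<in> moves X" for a b u v
    using that unfolding moves_def by clarify (metis add.assoc)
  have closed: "Poly_Mapping.single u c * f \<in> ?S" "f * Poly_Mapping.single u c \<in> ?S"
    if "f \<in> ?S" for f u c
  proof -
    have "Poly_Mapping.single u c * f \<in> ?S \<and> f * Poly_Mapping.single u c \<in> ?S"
      using that
    proof (induction rule: monoid_algebra.span_induct_alt)
      case base
      show ?case by (simp add: monoid_algebra.span_zero)
    next
      case (step e d f)
      then obtain a b where ab: "(a, b) \<in> moves X" "d = difference (a, b)"
        by auto
      have "(u + a, u + b) \<in> moves X" "(a + u, b + u) \<in> moves X"
        using moves_mult[OF ab(1), of u 0] moves_mult[OF ab(1), of 0 u] by simp_all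
      then have "scale (c * e) (difference (u + a, u + b)) \<in> ?S"
        "scale (c * e) (difference (a + u, b + u)) \<in> ?S"
        by (simp_all add: monoid_algebra.span_scale monoid_algebra.span_base)
      moreover have "Poly_Mapping.single u c * (scale e d) = scale (c * e) (difference (u + a, u + b))"
        "scale e d * Poly_Mapping.single u c = scale (c * e) (difference (a + u, b + u))"
        by (simp_all add: ab(2) difference_def left_diff_distrib right_diff_distrib mult_single
            mult.commute[of e c])
      ultimately show ?case
        using step by (simp add: distrib_left distrib_right monoid_algebra.span_add)
    qed
    then show "Poly_Mapping.single u c * f \<in> ?S" "f * Poly_Mapping.single u c \<in> ?S"
      by simp_all
  qed
  have mult: "a * f \<in> ?S \<and> f * a \<in> ?S" if "f \<in> ?S" for a f
    by (induction a rule: monoid_algebra_induct)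
      (simp_all add: closed that distrib_left distrib_right monoid_algebra.span_add)
  have "ideal ?S free_algebra"
    by (rule ideal_free_algebraI)
      (simp_all add: mult monoid_algebra.span_zero monoid_algebra.span_add)
  moreover have "?R \<subseteq> ?S"
  proof clarify
    fix x y
    have "(Word [x, y], Word [x \<rhd>\<^bsub>X\<^esub> y, x \<bullet>\<^bsub>X\<^esub> y]) \<in> moves X"
      unfolding moves_def by clarify (metis add_0_left add_0_right)
    then have "difference (Word [x, y], Word [x \<rhd>\<^bsub>X\<^esub> y, x \<bullet>\<^bsub>X\<^esub> y]) \<in> ?S"
      by (intro monoid_algebra.span_base imageI)
    then show "gen x * gen y - gen (x \<rhd>\<^bsub>X\<^esub> y) * gen (x \<bullet>\<^bsub>X\<^esub> y) \<in> ?S"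
      by (simp add: difference_def gen_mult)
  qed
  ultimately show "?I \<subseteq> ?S"
    unfolding relation_ideal_def by (rule ring.genideal_minimal[OF ring_free_algebra])
qed

text \<open>A linear map sends the span of the differences to the span of their images, so only the
  effect of \<open>t\<close> on pairs of words matters.\<close>

lemma extend_map_relation_ideal:
  "extend_map t ` relation_ideal X
   = monoid_algebra.span (difference ` map_prod t t ` moves X :: ('x word \<Rightarrow>\<^sub>0 'k::field) set)"
proof -
  have "extend_map t ` difference ` A = (difference ` map_prod t t ` A :: ('x word \<Rightarrow>\<^sub>0 'k) set)" for A
    unfolding image_image
    by (rule image_cong)
      (simp_all add: difference_def linear_extension_diff mult_single split: prod.split)
  then show ?thesis
    by (simp add: relation_ideal_eq_span module_hom.span_image[OF module_hom_linear_extension, symmetric])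
qed

text \<open>Applying a homomorphism to every letter turns a move into a move. Hence
  \<open>\<phi> s\<close> induces a map on the quotient.\<close>

lemma free_algebra_map_relation_ideal:
  assumes "\<And>x y. h (x \<rhd>\<^bsub>X\<^esub> y) = h x \<rhd>\<^bsub>X\<^esub> h y" "\<And>x y. h (x \<bullet>\<^bsub>X\<^esub> y) = h x \<bullet>\<^bsub>X\<^esub> h y"
    and "f \<in> relation_ideal X"
  shows "free_algebra_map h f \<in> relation_ideal X"
proof -
  have map_word_plus: "map_word h (v + w) = map_word h v + map_word h w" for v w
    by (cases v; cases w) (simp add: plus_word_def)
  have "map_prod (map_word h) (map_word h) ` moves X \<subseteq> moves X"
    unfolding moves_def by (auto simp: map_word_plus assms(1,2)) blast
  then have "extend_map (map_word h) ` relation_ideal X \<subseteq> relation_ideal X"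
    unfolding extend_map_relation_ideal unfolding relation_ideal_eq_span[of X]
    by (intro monoid_algebra.span_mono image_mono)
  then show ?thesis
    using assms(3) by (auto simp: free_algebra_map_eq)
qed


section \<open>Powers of commuting maps\<close>

text \<open>Both products have the same order and exponents, so a relation between partial products
  can be carried along. It serves to compare powers of maps of letters with powers of the induced
  maps of classes.\<close>

lemma multi_power_induct2:
  assumes "Q id id"
    and "\<And>s f g. s \<in> {1..p} \<Longrightarrow> Q f g \<Longrightarrow> Q (\<phi> s \<circ> f) (\<psi> s \<circ> g)"
  shows "Q (multi_power p \<phi> d) (multi_power p \<psi> d)"
proof -
  have iter: "Q ((\<phi> s ^^ n) \<circ> f) ((\<psi> s ^^ n) \<circ> g)" if "s \<in> {1..p}" "Q f g" for s n f g
    using that assms(2) by (induction n) (simp_all add: o_assoc[symmetric])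
  have "Q (foldr (\<lambda>s f. (\<phi> s ^^ d s) \<circ> f) ss id) (foldr (\<lambda>s g. (\<psi> s ^^ d s) \<circ> g) ss id)"
    if "set ss \<subseteq> {1..p}" for ss
    using that by (induction ss) (simp_all add: assms(1) iter)
  then show ?thesis
    by (simp add: multi_power_def atLeastLessThanSuc_atLeastAtMost del: upt_Suc)
qed

lemma multi_power_induct:
  assumes "Q id" "\<And>s f. s \<in> {1..p} \<Longrightarrow> Q f \<Longrightarrow> Q (\<phi> s \<circ> f)"
  shows "Q (multi_power p \<phi> d)"
  using assms by (rule multi_power_induct2[where Q = "\<lambda>f _. Q f"])

lemma multi_power_zero: "multi_power p \<phi> (\<lambda>_. 0) = id"
proof -
  have "foldr (\<lambda>s g. (\<phi> s ^^ 0) \<circ> g) ss id = id" for ss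
    by (induction ss) simp_all
  then show ?thesis
    by (simp add: multi_power_def)
qed

text \<open>The two sides have the same factors in different orders. Commutativity lets the power of
  \<open>\<phi> s\<close> with exponent \<open>e s\<close> pass the remaining factors with exponents
  from \<open>d\<close>.\<close>

lemma multi_power_add:
  assumes "\<And>s t. s \<in> {1..p} \<Longrightarrow> t \<in> {1..p} \<Longrightarrow> \<phi> s \<circ> \<phi> t = \<phi> t \<circ> \<phi> s"
  shows "multi_power p \<phi> (\<lambda>i. d i + e i) = multi_power p \<phi> d \<circ> multi_power p \<phi> e"
proof -
  have comp: "f \<circ> (g \<circ> h) = (g \<circ> h) \<circ> f" if "f \<circ> g = g \<circ> f" "f \<circ> h = h \<circ> f" for f g h :: "'a \<Rightarrow> 'a"
    using that by (metis o_assoc)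
  have iter: "f \<circ> (g ^^ n) = (g ^^ n) \<circ> f" if "f \<circ> g = g \<circ> f" for f g :: "'a \<Rightarrow> 'a" and n
  proof (induction n)
    case (Suc n)
    show ?case
      unfolding funpow.simps by (rule comp[OF that Suc.IH])
  qed simp
  have commute: "(\<phi> s ^^ m) \<circ> (\<phi> t ^^ n) = (\<phi> t ^^ n) \<circ> (\<phi> s ^^ m)"
    if "s \<in> {1..p}" "t \<in> {1..p}" for s t m n
    by (rule iter, rule iter[symmetric], rule assms[OF that(2,1)])
  \<comment> \<open>Replacing \<open>[1..<Suc p]\<close> by any list of indices from
    \<open>{1..p}\<close> permits induction on the list.\<close>
  define F where "F ss d = foldr (\<lambda>s g. (\<phi> s ^^ d s) \<circ> g) ss id" for ss d
  have F_Nil: "F [] d = id" and F_Cons: "F (s # ss) d = (\<phi> s ^^ d s) \<circ> F ss d" for s ss d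
    by (simp_all add: F_def)
  have commute': "(\<phi> s ^^ m) \<circ> F ss d = F ss d \<circ> (\<phi> s ^^ m)"
    if "s \<in> {1..p}" "set ss \<subseteq> {1..p}" for s ss m d
    using that(2)
  proof (induction ss)
    case (Cons t ss)
    then show ?case
      unfolding F_Cons by (intro comp commute that(1) Cons.IH) simp_all
  qed (simp add: F_Nil)
  have "F ss (\<lambda>i. d i + e i) = F ss d \<circ> F ss e" if "set ss \<subseteq> {1..p}" for ss
    using that
  proof (induction ss)
    case (Cons s ss)
    then have "(\<phi> s ^^ e s) \<circ> F ss d = F ss d \<circ> (\<phi> s ^^ e s)"
      by (intro commute') auto
    with Cons show ?case
      by (simp add: F_Cons funpow_add fun_eq_iff)
  qed (simp add: F_Nil)
  then show ?thesis
    by (simp add: F_def multi_power_def atLeastLessThanSuc_atLeastAtMost del: upt_Suc)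
qed


section \<open>The homogeneous components of a class\<close>

lemma word_degree_plus:
  "word_degree p P (v + w) = (\<lambda>i. word_degree p P v i + word_degree p P w i)"
  by (simp add: word_degree_def plus_word_def)

lemma word_degree_zero: "word_degree p P 0 = (\<lambda>_. 0)"
  by (simp add: word_degree_def zero_word_def)

lemma word_degree_Cons:
  "word_degree p P (Word (x # xs)) = (\<lambda>i. degree_of p P x i + word_degree p P (Word xs) i)"
  by (simp add: word_degree_def)

lemma word_degree_map:
  assumes "\<And>x. degree_of p P (h x) = degree_of p P x"
  shows "word_degree p P (map_word h w) = word_degree p P w"
  by (cases w) (simp add: word_degree_def assms o_def)

text \<open>The projection of the free algebra onto the span of the words of degree
  \<open>d\<close>; as a linear extension it is linear by construction.\<close>

definition homogeneous_part ::
    "nat \<Rightarrow> (nat \<Rightarrow> 'x set) \<Rightarrow> multidegree \<Rightarrow> ('x word \<Rightarrow>\<^sub>0 'k::field) \<Rightarrow> 'x word \<Rightarrow>\<^sub>0 'k" where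
  "homogeneous_part p P d =
     linear_extension (\<lambda>w. if word_degree p P w = d then Poly_Mapping.single w 1 else 0)"

lemma homogeneous_part_diff:
  "homogeneous_part p P d (f - g) = homogeneous_part p P d f - homogeneous_part p P d g"
  by (simp add: homogeneous_part_def linear_extension_diff)

lemma homogeneous_part_sum:
  "homogeneous_part p P d (\<Sum>e\<in>S. F e) = (\<Sum>e\<in>S. homogeneous_part p P d (F e))"
  unfolding homogeneous_part_def by (rule module_hom.sum[OF module_hom_linear_extension])

lemma homogeneous_part_eq_sum:
  "homogeneous_part p P d f = (\<Sum>w\<in>{w \<in> Poly_Mapping.keys f. word_degree p P w = d}.
     Poly_Mapping.single w (Poly_Mapping.lookup f w))"
  by (simp add: homogeneous_part_def linear_extension_def mult_single if_distrib[of "(*) _"]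
      sum.inter_filter[symmetric] cong: if_cong)

lemma keys_homogeneous_part:
  assumes "w \<in> Poly_Mapping.keys (homogeneous_part p P d f)"
  shows "word_degree p P w = d"
  using assms unfolding homogeneous_part_eq_sum
  by (auto dest!: subsetD[OF keys_sum] split: if_splits)

lemma homogeneous_part_homogeneous:
  fixes f :: "'x word \<Rightarrow>\<^sub>0 'k::field"
  assumes "\<And>w. w \<in> Poly_Mapping.keys f \<Longrightarrow> word_degree p P w = e"
  shows "homogeneous_part p P d f = (if e = d then f else 0)"
proof -
  have "homogeneous_part p P d f =
      (if e = d then \<Sum>w\<in>Poly_Mapping.keys f. Poly_Mapping.single w (Poly_Mapping.lookup f w) else 0)"
    unfolding homogeneous_part_eq_sum
    by (cases "e = d") (auto intro!: sum.cong sum.neutral simp: assms)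
  moreover have "(\<Sum>w\<in>Poly_Mapping.keys f. Poly_Mapping.single w (Poly_Mapping.lookup f w)) = f"
    using extend_map_id[of f] by (simp add: linear_extension_def mult_single)
  ultimately show ?thesis
    by simp
qed

lemma homogeneous_part_eq_0:
  "d \<notin> word_degree p P ` Poly_Mapping.keys f \<Longrightarrow> homogeneous_part p P d f = 0"
  unfolding homogeneous_part_eq_sum by (rule sum.neutral) auto

text \<open>Exchanges summation over degrees, as in the Zhang product, for summation over words.
  Each word occurs in the part of its own degree only.\<close>

lemma sum_homogeneous_part_mult:
  fixes f :: "'x word \<Rightarrow>\<^sub>0 'k::field"
  assumes "finite D" "word_degree p P ` Poly_Mapping.keys f \<subseteq> D"
  shows "(\<Sum>d\<in>D. homogeneous_part p P d f * G d)
    = linear_extension (\<lambda>w. Poly_Mapping.single w 1 * G (word_degree p P w)) f"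
proof -
  have "(\<Sum>d\<in>D. homogeneous_part p P d f * G d)
      = (\<Sum>d\<in>D. \<Sum>w\<in>Poly_Mapping.keys f. if word_degree p P w = d
          then Poly_Mapping.single w (Poly_Mapping.lookup f w) * G d else 0)"
    by (auto simp: homogeneous_part_eq_sum sum_distrib_right sum.inter_filter intro!: sum.cong)
  also have "\<dots> = (\<Sum>w\<in>Poly_Mapping.keys f. \<Sum>d\<in>D. if word_degree p P w = d
          then Poly_Mapping.single w (Poly_Mapping.lookup f w) * G d else 0)"
    by (rule sum.swap)
  also have "\<dots> = (\<Sum>w\<in>Poly_Mapping.keys f.
      Poly_Mapping.single w (Poly_Mapping.lookup f w) * G (word_degree p P w))"
    by (rule sum.cong) (use assms in \<open>auto simp: sum.delta'\<close>)
  finally show ?thesis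
    by (simp add: linear_extension_def mult_single flip: mult.assoc)
qed

lemma sum_homogeneous_part:
  fixes f :: "'x word \<Rightarrow>\<^sub>0 'k::field"
  assumes "finite D" "word_degree p P ` Poly_Mapping.keys f \<subseteq> D"
  shows "(\<Sum>d\<in>D. homogeneous_part p P d f) = f"
  using sum_homogeneous_part_mult[OF assms, of "\<lambda>_. 1"] extend_map_id[of f] by simp

section \<open>Degrees of letters and graded automorphisms\<close>

lemma degree_of_eq:
  assumes "graded_birack p P X" "i \<in> {1..p}" "x \<in> P i"
  shows "degree_of p P x = (\<lambda>j. if j = i then 1 else 0)"
proof -
  have "(THE i. i \<in> {1..p} \<and> x \<in> P i) = i"
    using assms unfolding graded_birack_def disjoint_family_on_def
    by (intro the_equality) (blast, metis IntI empty_iff)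
  then show ?thesis
    by (simp add: degree_of_def)
qed

lemma graded_birack_part:
  assumes "graded_birack p P X"
  obtains i where "i \<in> {1..p}" "x \<in> P i"
proof -
  have "x \<in> (\<Union>i\<in>{1..p}. P i)"
    using assms by (simp add: graded_birack_def)
  then show thesis
    using that by blast
qed

lemma degree_of_circ:
  assumes "graded_birack p P X"
  shows "degree_of p P (x \<rhd>\<^bsub>X\<^esub> y) = degree_of p P y"
proof -
  obtain i where "i \<in> {1..p}" "y \<in> P i"
    by (rule graded_birack_part[OF assms])
  moreover from this have "x \<rhd>\<^bsub>X\<^esub> y \<in> P i"
    using assms by (simp add: graded_birack_def)
  ultimately show ?thesis
    using degree_of_eq[OF assms] by simp
qed

lemma degree_of_bul:
  assumes "graded_birack p P X"
  shows "degree_of p P (y \<bullet>\<^bsub>X\<^esub> x) = degree_of p P y"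
proof -
  obtain i where "i \<in> {1..p}" "y \<in> P i"
    by (rule graded_birack_part[OF assms])
  moreover from this have "y \<bullet>\<^bsub>X\<^esub> x \<in> P i"
    using assms by (simp add: graded_birack_def)
  ultimately show ?thesis
    using degree_of_eq[OF assms] by simp
qed

lemma degree_of_automorphism:
  assumes "graded_birack p P X" "graded_birack_automorphism p P X f"
  shows "degree_of p P (f x) = degree_of p P x"
proof -
  obtain i where "i \<in> {1..p}" "x \<in> P i"
    by (rule graded_birack_part[OF assms(1)])
  moreover from this have "f x \<in> P i"
    using assms(2) unfolding graded_birack_automorphism_def by blast
  ultimately show ?thesis
    using degree_of_eq[OF assms(1)] by simp
qed

lemma graded_birack_automorphism_comp:
  assumes f: "graded_birack_automorphism p P X f" and g: "graded_birack_automorphism p P X g"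
  shows "graded_birack_automorphism p P X (f \<circ> g)"
  unfolding graded_birack_automorphism_def
proof (intro conjI ballI allI)
  show "bij (f \<circ> g)"
    using f g by (auto simp: graded_birack_automorphism_def intro: bij_comp)
  fix i assume "i \<in> {1..p}"
  then have "f ` P i \<subseteq> P i" "g ` P i \<subseteq> P i"
    using f g by (simp_all only: graded_birack_automorphism_def)
  then show "(f \<circ> g) ` P i \<subseteq> P i"
    by auto
next
  fix x y
  show "(f \<circ> g) (x \<rhd>\<^bsub>X\<^esub> y) = (f \<circ> g) x \<rhd>\<^bsub>X\<^esub> (f \<circ> g) y"
    "(f \<circ> g) (x \<bullet>\<^bsub>X\<^esub> y) = (f \<circ> g) x \<bullet>\<^bsub>X\<^esub> (f \<circ> g) y"
    using f g by (simp_all add: graded_birack_automorphism_def)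
qed

lemma word_degree_mem_multidegrees:
  assumes "graded_birack p P X"
  shows "word_degree p P w \<in> multidegrees p"
proof -
  have "degree_of p P x j = 0" if "j \<notin> {1..p}" for x j
  proof -
    obtain i where "i \<in> {1..p}" "x \<in> P i"
      by (rule graded_birack_part[OF assms])
    then show ?thesis
      using that degree_of_eq[OF assms] by auto
  qed
  then show ?thesis
    by (simp add: multidegrees_def word_degree_def)
qed

text \<open>Both words of a defining relation have the same degree, so the ideal is homogeneous.\<close>

lemma homogeneous_part_relation_ideal:
  fixes f :: "'x word \<Rightarrow>\<^sub>0 'k::field"
  assumes "graded_birack p P X" "f \<in> relation_ideal X"
  shows "homogeneous_part p P d f \<in> relation_ideal X"
proof -
  have "homogeneous_part p P d (difference (a, b)) \<in> (relation_ideal X :: ('x word \<Rightarrow>\<^sub>0 'k) set)"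
    if ab: "(a, b) \<in> moves X" for a b
  proof -
    have "word_degree p P a = word_degree p P b"
      using ab unfolding moves_def
      by (auto simp: word_degree_plus word_degree_Cons degree_of_circ[OF assms(1)]
          degree_of_bul[OF assms(1)])
    then have "homogeneous_part p P d (difference (a, b) :: 'x word \<Rightarrow>\<^sub>0 'k)
        = (if word_degree p P a = d then difference (a, b) else 0)"
      by (intro homogeneous_part_homogeneous)
        (auto simp: difference_def dest!: subsetD[OF keys_diff])
    with ab show ?thesis
      unfolding relation_ideal_eq_span
      by (auto intro: monoid_algebra.span_base monoid_algebra.span_zero)
  qed
  then have "homogeneous_part p P d ` difference ` moves X
      \<subseteq> (relation_ideal X :: ('x word \<Rightarrow>\<^sub>0 'k) set)"
    by auto
  then have "homogeneous_part p P d ` relation_ideal X \<subseteq> (relation_ideal X :: ('x word \<Rightarrow>\<^sub>0 'k) set)"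
    unfolding homogeneous_part_def relation_ideal_eq_span
    by (simp add: module_hom.span_image[OF module_hom_linear_extension, symmetric]
        monoid_algebra.span_minimal monoid_algebra.subspace_span)
  then show ?thesis
    using assms(2) by blast
qed

section \<open>Homogeneous components in the quotient\<close>

global_interpretation relation_ideal: free_algebra_ideal
  "relation_ideal X :: ('x word \<Rightarrow>\<^sub>0 'k::field) set" for X
  by (rule free_algebra_ideal.intro[OF relation_ideal_is_ideal])

text \<open>Bridges two index sets: the degrees that occur in a representative, and the fewer
  degrees whose class is nonzero.\<close>

lemma (in free_algebra_ideal) finsum_quotient_subset:
  assumes "finite D" "S \<subseteq> D" "\<And>d. d \<in> D - S \<Longrightarrow> f d \<in> I"
  shows "(\<Oplus>\<^bsub>Q\<^esub>d\<in>S. coset (f d)) = coset (\<Sum>d\<in>D. f d)"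
proof -
  have "(\<Sum>d\<in>A. f d) \<in> I" if "finite A" "A \<subseteq> D - S" for A
    using that by induction (auto simp: zero_mem intro: add_mem assms(3))
  then have "(\<Sum>d\<in>D - S. f d) \<in> I"
    using assms(1) by simp
  moreover have "(\<Sum>d\<in>D. f d) - (\<Sum>d\<in>S. f d) = (\<Sum>d\<in>D - S. f d)"
    using sum_diff[OF assms(1,2), of f] by simp
  ultimately have "coset (\<Sum>d\<in>D. f d) = coset (\<Sum>d\<in>S. f d)"
    by (simp add: coset_eq_iff)
  then show ?thesis
    using finsum_quotient finite_subset[OF assms(2,1)] by metis
qed

text \<open>The homogeneous parts of \<open>f\<close> add up to \<open>f\<close>, which gives
  existence. For uniqueness, lift a competing family to homogeneous elements: \<open>f\<close> minus
  their sum lies in the ideal, and so does each homogeneous part of this difference, since the ideal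
  is homogeneous.\<close>

lemma homogeneous_components_coset:
  fixes X :: "'x birack_ops" and f :: "'x word \<Rightarrow>\<^sub>0 'k::field"
  assumes "graded_birack p P X"
  shows "homogeneous_components p (birack_algebra X) (birack_algebra_grading p P X)
      (relation_ideal.coset X f) = (\<lambda>d. relation_ideal.coset X (homogeneous_part p P d f))"
    (is "_ = ?c")
  unfolding homogeneous_components_def birack_algebra_def
proof (rule the_equality)
  let ?D = "word_degree p P ` Poly_Mapping.keys f"
  let ?S = "{d. ?c d \<noteq> \<zero>\<^bsub>relation_ideal.Q X\<^esub>}"
  have S: "?S \<subseteq> ?D"
    using homogeneous_part_eq_0[of _ p P f] by (auto simp: relation_ideal.zero_quotient)
  have "(\<Oplus>\<^bsub>relation_ideal.Q X\<^esub>d\<in>?S. ?c d) =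
      relation_ideal.coset X (\<Sum>d\<in>?D. homogeneous_part p P d f)"
    using S by (intro relation_ideal.finsum_quotient_subset)
      (auto simp: relation_ideal.zero_quotient relation_ideal.coset_zero
        relation_ideal.coset_eq_ideal_iff)
  also have "(\<Sum>d\<in>?D. homogeneous_part p P d f) = f"
    by (rule sum_homogeneous_part) auto
  finally have "relation_ideal.coset X f = (\<Oplus>\<^bsub>relation_ideal.Q X\<^esub>d\<in>?S. ?c d)" ..
  moreover have "?c d \<in> birack_algebra_grading p P X d" for d
    unfolding birack_algebra_grading_def using keys_homogeneous_part by blast
  moreover have "?c d = \<zero>\<^bsub>relation_ideal.Q X\<^esub>" if "d \<notin> multidegrees p" for d
  proof -
    have "d \<notin> ?D"
      using that word_degree_mem_multidegrees[OF assms] by auto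
    then show ?thesis
      by (simp add: homogeneous_part_eq_0 relation_ideal.zero_quotient)
  qed
  moreover have "finite ?S"
    using S by (rule finite_subset) simp
  ultimately show "(\<forall>d\<in>multidegrees p. ?c d \<in> birack_algebra_grading p P X d) \<and>
      (\<forall>d. d \<notin> multidegrees p \<longrightarrow> ?c d = \<zero>\<^bsub>relation_ideal.Q X\<^esub>) \<and> finite ?S \<and>
      relation_ideal.coset X f = (\<Oplus>\<^bsub>relation_ideal.Q X\<^esub>d\<in>?S. ?c d)"
    by blast
next
  fix c :: "multidegree \<Rightarrow> ('x word \<Rightarrow>\<^sub>0 'k) set"
  let ?S = "{d. c d \<noteq> \<zero>\<^bsub>relation_ideal.Q X\<^esub>}"
  assume c: "(\<forall>d\<in>multidegrees p. c d \<in> birack_algebra_grading p P X d) \<and>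
      (\<forall>d. d \<notin> multidegrees p \<longrightarrow> c d = \<zero>\<^bsub>relation_ideal.Q X\<^esub>) \<and> finite ?S \<and>
      relation_ideal.coset X f = (\<Oplus>\<^bsub>relation_ideal.Q X\<^esub>d\<in>?S. c d)"
  \<comment> \<open>Outside \<open>multidegrees p\<close> the representative is 0, which is
    vacuously homogeneous of every degree.\<close>
  have "\<exists>g. c d = relation_ideal.coset X g \<and> (\<forall>w\<in>Poly_Mapping.keys g. word_degree p P w = d)" for d
  proof (cases "d \<in> multidegrees p")
    case True
    then show ?thesis
      using c unfolding birack_algebra_grading_def by blast
  next
    case False
    then show ?thesis
      using c by (intro exI[of _ 0]) (simp add: relation_ideal.zero_quotient)
  qed
  then obtain F where F: "\<And>d. c d = relation_ideal.coset X (F d)"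
    and homogeneous: "\<And>d w. w \<in> Poly_Mapping.keys (F d) \<Longrightarrow> word_degree p P w = d"
    by metis
  have "relation_ideal.coset X f = relation_ideal.coset X (\<Sum>d\<in>?S. F d)"
    using c relation_ideal.finsum_quotient[of ?S X F] by (simp flip: F)
  then have mem: "f - (\<Sum>d\<in>?S. F d) \<in> relation_ideal X"
    by (simp add: relation_ideal.coset_eq_iff)
  show "c = ?c"
  proof
    fix e
    \<comment> \<open>Only the summand of index \<open>e\<close> survives. If \<open>e\<close> is
      not in \<open>?S\<close>, then \<open>c e\<close> is the zero class and is represented by
      0.\<close>
    have "homogeneous_part p P e (\<Sum>d\<in>?S. F d) = (\<Sum>d\<in>?S. if d = e then F e else 0)"
      unfolding homogeneous_part_sum
    proof (rule sum.cong)
      show "homogeneous_part p P e (F d) = (if d = e then F e else 0)" for d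
        using homogeneous_part_homogeneous[of "F d" p P d e, OF homogeneous] by simp
    qed simp
    also have "\<dots> = (if e \<in> ?S then F e else 0)"
      using c by (simp add: sum.delta)
    finally have "homogeneous_part p P e f - (if e \<in> ?S then F e else 0) \<in> relation_ideal X"
      using homogeneous_part_relation_ideal[OF assms mem, of e] by (simp add: homogeneous_part_diff)
    then have "?c e = relation_ideal.coset X (if e \<in> ?S then F e else 0)"
      by (simp only: relation_ideal.coset_eq_iff)
    also have "\<dots> = c e"
      using F[of e] by (simp add: relation_ideal.zero_quotient)
    finally show "c e = ?c e" ..
  qed
qed


section \<open>Twisting words\<close>

text \<open>Each letter acts on the whole tail, already twisted, so a letter collects the powers for
  the degrees of all letters before it.\<close>

primrec twist_list :: "nat \<Rightarrow> (nat \<Rightarrow> 'x set) \<Rightarrow> (nat \<Rightarrow> 'x \<Rightarrow> 'x) \<Rightarrow> 'x list \<Rightarrow> 'x list" where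
  "twist_list p P \<phi> [] = []"
| "twist_list p P \<phi> (x # xs) = x # map (multi_power p \<phi> (degree_of p P x)) (twist_list p P \<phi> xs)"

locale commuting_graded_automorphisms = involutive_birack X
  for X :: "'x birack_ops" (structure) +
  fixes p :: nat and P :: "nat \<Rightarrow> 'x set" and \<phi> :: "nat \<Rightarrow> 'x \<Rightarrow> 'x"
  assumes graded: "graded_birack p P X"
    and automorphism: "s \<in> {1..p} \<Longrightarrow> graded_birack_automorphism p P X (\<phi> s)"
    and commute: "s \<in> {1..p} \<Longrightarrow> t \<in> {1..p} \<Longrightarrow> \<phi> s \<circ> \<phi> t = \<phi> t \<circ> \<phi> s"
begin

abbreviation \<Phi> :: "multidegree \<Rightarrow> 'x \<Rightarrow> 'x" where
  "\<Phi> \<equiv> multi_power p \<phi>"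

abbreviation degree :: "'x word \<Rightarrow> multidegree" where
  "degree \<equiv> word_degree p P"

abbreviation coset :: "('x word \<Rightarrow>\<^sub>0 'k::field) \<Rightarrow> ('x word \<Rightarrow>\<^sub>0 'k) set" where
  "coset \<equiv> relation_ideal.coset X"

definition twist :: "'x word \<Rightarrow> 'x word" where
  "twist w = Word (twist_list p P \<phi> (letters w))"

lemma automorphism_power: "graded_birack_automorphism p P X (\<Phi> d)"
proof (rule multi_power_induct[where Q = "graded_birack_automorphism p P X"])
  show "graded_birack_automorphism p P X id"
    by (simp add: graded_birack_automorphism_def)
  show "graded_birack_automorphism p P X (\<phi> s \<circ> f)"
    if "s \<in> {1..p}" "graded_birack_automorphism p P X f" for s f
    using automorphism[OF that(1)] that(2) by (rule graded_birack_automorphism_comp)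
qed

lemma bij_power: "bij (\<Phi> d)"
  using automorphism_power by (simp add: graded_birack_automorphism_def)

lemma power_circ: "\<Phi> d (x \<rhd> y) = \<Phi> d x \<rhd> \<Phi> d y"
  and power_bul: "\<Phi> d (x \<bullet> y) = \<Phi> d x \<bullet> \<Phi> d y"
  using automorphism_power by (simp_all add: graded_birack_automorphism_def)

lemma degree_of_power: "degree_of p P (\<Phi> d x) = degree_of p P x"
  by (rule degree_of_automorphism[OF graded automorphism_power])

lemma degree_power: "degree (map_word (\<Phi> d) w) = degree w"
  by (rule word_degree_map) (rule degree_of_power)

lemma power_zero: "\<Phi> (\<lambda>_. 0) = id"
  by (rule multi_power_zero)

lemma power_add: "\<Phi> (\<lambda>i. d i + e i) = \<Phi> d \<circ> \<Phi> e"
  by (rule multi_power_add) (rule commute)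

text \<open>By induction on \<open>xs\<close>: the power for the head is composed with the power for
  the rest, and \<open>power_add\<close> merges them into the power for the total degree.\<close>

lemma twist_list_append:
  "twist_list p P \<phi> (xs @ ys)
   = twist_list p P \<phi> xs @ map (\<Phi> (degree (Word xs))) (twist_list p P \<phi> ys)"
proof (induction xs)
  case Nil
  then show ?case
    using word_degree_zero[of p P] by (simp add: zero_word_def power_zero)
qed (simp add: word_degree_Cons power_add)

lemma twist_zero: "twist 0 = 0"
  by (simp add: twist_def zero_word_def)

lemma twist_plus: "twist (v + w) = twist v + map_word (\<Phi> (degree v)) (twist w)"
  by (cases v; cases w) (simp add: twist_def plus_word_def twist_list_append)

lemma degree_twist: "degree (twist w) = degree w"
proof -
  have "degree (Word (twist_list p P \<phi> xs)) = degree (Word xs)" for xs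
  proof (induction xs)
    case (Cons x xs)
    then show ?case
      using degree_power[of _ "Word (twist_list p P \<phi> xs)"] by (simp add: word_degree_Cons)
  qed simp
  then show ?thesis
    by (cases w) (simp add: twist_def)
qed

text \<open>The first letter is unchanged and determines the power applied to the tail; this power
  is bijective, so a word can be untwisted from left to right.\<close>

lemma bij_twist: "bij twist"
proof (rule bijI)
  have "xs = ys" if "twist_list p P \<phi> xs = twist_list p P \<phi> ys" for xs ys
    using that
  proof (induction xs arbitrary: ys)
    case Nil
    then show ?case by (cases ys) simp_all
  next
    case (Cons x xs)
    then show ?case
      by (cases ys) (auto dest: map_injective intro: bij_is_inj[OF bij_power])
  qed
  then show "inj twist"
    by (auto intro!: injI word.expand simp: twist_def)
  have "\<exists>xs. twist_list p P \<phi> xs = ys" for ys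
  \<comment> \<open>Induction on the length, because the hypothesis is applied to the tail moved by
    an inverse power, not to the tail itself.\<close>
  proof (induction ys rule: length_induct)
    case (1 ys)
    show ?case
    proof (cases ys)
      case Nil
      then show ?thesis by (auto intro: exI[of _ "[]"])
    next
      case (Cons y ys')
      let ?f = "\<Phi> (degree_of p P y)"
      obtain xs where "twist_list p P \<phi> xs = map (inv_into UNIV ?f) ys'"
        using 1 Cons by (metis length_Cons length_map lessI)
      then have "twist_list p P \<phi> (y # xs) = ys"
        using Cons by (simp add: o_def surj_f_inv_f[OF bij_is_surj[OF bij_power]])
      then show ?thesis ..
    qed
  qed
  then show "surj twist"
    unfolding surj_def twist_def by (metis word.collapse word.sel)
qed

section \<open>The twist and the relations of the isotope\<close>

abbreviation Y :: "'x birack_ops" where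
  "Y \<equiv> isotope p P \<phi> X"

lemma isotope_circ_eq: "x \<rhd>\<^bsub>Y\<^esub> y = x \<rhd> \<Phi> (degree_of p P x) y"
  by (simp add: isotope_def isotope_circ_def)

text \<open>The power on the left cancels the inverse power in the left division of the isotope.
  What remains is the division of \<open>x\<close> by \<open>x \<rhd> ?y\<close>; involutivity
  writes \<open>x\<close> as \<open>(x \<rhd> ?y) \<rhd> (x \<bullet> ?y)\<close>.\<close>

lemma power_isotope_bul:
  "\<Phi> (degree_of p P (x \<rhd>\<^bsub>Y\<^esub> y)) (x \<bullet>\<^bsub>Y\<^esub> y) = x \<bullet> \<Phi> (degree_of p P x) y"
proof -
  let ?y = "\<Phi> (degree_of p P x) y"
  have "\<Phi> (degree_of p P (x \<rhd>\<^bsub>Y\<^esub> y)) (x \<bullet>\<^bsub>Y\<^esub> y) = ldiv X (x \<rhd> ?y) x"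
    by (simp add: isotope_def isotope_bul_def isotope_ldiv_def isotope_circ_def
        surj_f_inv_f[OF bij_is_surj[OF bij_power]])
  also have "\<dots> = ldiv X (x \<rhd> ?y) ((x \<rhd> ?y) \<rhd> (x \<bullet> ?y))"
    by (simp add: invol_circ)
  also have "\<dots> = x \<bullet> ?y"
    using left_quasi by (simp add: left_quasigroup_def)
  finally show ?thesis .
qed

lemma degree_of_isotope_circ: "degree_of p P (x \<rhd>\<^bsub>Y\<^esub> y) = degree_of p P y"
  by (simp add: isotope_circ_eq degree_of_circ[OF graded] degree_of_power)

lemma degree_of_isotope_bul: "degree_of p P (x \<bullet>\<^bsub>Y\<^esub> y) = degree_of p P x"
  using arg_cong[OF power_isotope_bul, of "degree_of p P" x y]
  by (simp add: degree_of_power degree_of_bul[OF graded])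

text \<open>A move of the isotope after the prefix \<open>u\<close> becomes a move of
  \<open>X\<close>: the power belonging to \<open>u\<close> is an automorphism and passes into both
  operations.\<close>

lemma twist_move:
  fixes u v x y
  defines "x' \<equiv> \<Phi> (degree u) x" and "y' \<equiv> \<Phi> (degree u) (\<Phi> (degree_of p P x) y)"
    and "v' \<equiv> map_word (\<Phi> (degree (u + Word [x, y]))) (twist v)"
  shows "twist (u + Word [x, y] + v) = twist u + Word [x', y'] + v'"
    and "twist (u + Word [x \<rhd>\<^bsub>Y\<^esub> y, x \<bullet>\<^bsub>Y\<^esub> y] + v)
      = twist u + Word [x' \<rhd> y', x' \<bullet> y'] + v'"
proof -
  have two: "twist (Word [a, b]) = Word [a, \<Phi> (degree_of p P a) b]" for a b
    by (simp add: twist_def)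
  \<comment> \<open>The isotope operations swap the degrees of the two letters, so the total is
    unchanged and the suffix is twisted by the same power on both sides.\<close>
  have "degree (u + Word [x \<rhd>\<^bsub>Y\<^esub> y, x \<bullet>\<^bsub>Y\<^esub> y]) = degree (u + Word [x, y])"
    by (simp add: word_degree_plus word_degree_Cons degree_of_isotope_circ degree_of_isotope_bul
        ac_simps)
  moreover have "twist (Word [x \<rhd>\<^bsub>Y\<^esub> y, x \<bullet>\<^bsub>Y\<^esub> y])
      = Word [x \<rhd> \<Phi> (degree_of p P x) y, x \<bullet> \<Phi> (degree_of p P x) y]"
    unfolding two power_isotope_bul by (simp only: isotope_circ_eq)
  ultimately show "twist (u + Word [x \<rhd>\<^bsub>Y\<^esub> y, x \<bullet>\<^bsub>Y\<^esub> y] + v)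
      = twist u + Word [x' \<rhd> y', x' \<bullet> y'] + v'"
    by (simp add: twist_plus power_circ power_bul x'_def y'_def v'_def)
  show "twist (u + Word [x, y] + v) = twist u + Word [x', y'] + v'"
    by (simp add: twist_plus two x'_def y'_def v'_def)
qed

text \<open>An equality, not just an inclusion: with it the twist carries one ideal onto the other,
  as injectivity on the quotient requires.\<close>

lemma twist_moves: "map_prod twist twist ` moves Y = moves X"
proof
  show "map_prod twist twist ` moves Y \<subseteq> moves X"
    unfolding moves_def using twist_move by auto blast
  show "moves X \<subseteq> map_prod twist twist ` moves Y"
  proof clarify
    fix a b assume "(a, b) \<in> moves X"
    then obtain u0 v0 x0 y0 where ab: "a = u0 + Word [x0, y0] + v0"
      "b = u0 + Word [x0 \<rhd> y0, x0 \<bullet> y0] + v0"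
      by (auto simp: moves_def)
    \<comment> \<open>Preimages are found from left to right, since the powers to be inverted depend
      on the letters already found.\<close>
    obtain u where u: "twist u = u0"
      using bij_is_surj[OF bij_twist] by (metis surjD)
    obtain x where x: "\<Phi> (degree u) x = x0"
      using bij_is_surj[OF bij_power] by (metis surjD)
    obtain y where y: "\<Phi> (degree u) (\<Phi> (degree_of p P x) y) = y0"
      using bij_is_surj[OF bij_power] by (metis surjD)
    have "surj (map_word (\<Phi> d))" for d
      using bij_is_surj[OF bij_power[of d]]
      by (metis (no_types) surj_def surj_iff word.map_comp word.map_id o_def)
    then obtain v where v: "map_word (\<Phi> (degree (u + Word [x, y]))) (twist v) = v0"
      using bij_is_surj[OF bij_twist] by (metis surjD)
    have "(a, b) = map_prod twist twist
        (u + Word [x, y] + v, u + Word [x \<rhd>\<^bsub>Y\<^esub> y, x \<bullet>\<^bsub>Y\<^esub> y] + v)"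
      by (simp only: map_prod_simp twist_move[of u x y v] ab u x y v)
    then show "(a, b) \<in> map_prod twist twist ` moves Y"
      unfolding moves_def by blast
  qed
qed


section \<open>The isomorphism\<close>

abbreviation T :: "('x word \<Rightarrow>\<^sub>0 'k::field) \<Rightarrow> 'x word \<Rightarrow>\<^sub>0 'k" where
  "T \<equiv> extend_map twist"

lemma bij_T: "bij (T :: ('x word \<Rightarrow>\<^sub>0 'k::field) \<Rightarrow> _)"
proof (rule o_bij)
  show "extend_map (inv_into UNIV twist) \<circ> T = (id :: ('x word \<Rightarrow>\<^sub>0 'k) \<Rightarrow> _)"
    using bij_is_inj[OF bij_twist] by (simp add: fun_eq_iff extend_map_comp extend_map_id)
  show "T \<circ> extend_map (inv_into UNIV twist) = (id :: ('x word \<Rightarrow>\<^sub>0 'k) \<Rightarrow> _)"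
    using bij_is_surj[OF bij_twist] by (simp add: fun_eq_iff extend_map_comp extend_map_id surj_iff[THEN iffD1])
qed

lemma T_relation_ideal: "T ` relation_ideal Y = relation_ideal X"
  by (simp add: extend_map_relation_ideal twist_moves relation_ideal_eq_span[of X])

text \<open>Shows that the map induced by \<open>T\<close> on quotients is simply taking images of
  cosets as sets.\<close>

lemma T_coset: "T ` relation_ideal.coset Y f = coset (T f)"
proof -
  have "T ` relation_ideal.coset Y f = (\<lambda>i. i + T f) ` T ` relation_ideal Y"
    by (simp add: relation_ideal.coset_def image_image linear_extension_add)
  then show ?thesis
    by (simp only: T_relation_ideal relation_ideal.coset_def)
qed

text \<open>The Zhang product of the free algebra, with homogeneous components split further into
  words.\<close>

definition twisted_mult ::
    "('x word \<Rightarrow>\<^sub>0 'k::field) \<Rightarrow> ('x word \<Rightarrow>\<^sub>0 'k) \<Rightarrow> 'x word \<Rightarrow>\<^sub>0 'k" where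
  "twisted_mult f g =
     linear_extension (\<lambda>w. Poly_Mapping.single w 1 * free_algebra_map (\<Phi> (degree w)) g) f"

lemma twisted_mult_add: "twisted_mult f (g + g') = twisted_mult f g + twisted_mult f g'"
  by (simp add: twisted_mult_def linear_extension_def free_algebra_map_add distrib_left sum.distrib)

text \<open>Bilinearity reduces the claim to words, where it is \<open>twist_plus\<close>; by
  \<open>degree_twist\<close> the power may be read off from \<open>twist u\<close> instead of
  \<open>u\<close>.\<close>

lemma T_mult: "T (f * g) = twisted_mult (T f) (T g)"
proof (induction f rule: monoid_algebra_induct)
  case (add f f')
  then show ?case
    by (simp add: distrib_right linear_extension_add twisted_mult_def)
next
  case (single u a)
  show ?case
  proof (induction g rule: monoid_algebra_induct)
    case (single v b)
    show ?case
      by (simp add: mult_single twisted_mult_def twist_plus free_algebra_map_eq degree_twist)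
  next
    case (add g g')
    then show ?case
      by (simp add: distrib_left linear_extension_add twisted_mult_add)
  qed
qed

text \<open>Each \<open>\<phi> s\<close> preserves the ideal and so acts on classes through
  representatives; this passes to products of powers by the simultaneous induction.\<close>

lemma multi_power_coset:
  fixes g :: "'x word \<Rightarrow>\<^sub>0 'k::field"
  shows "multi_power p (\<lambda>s. birack_algebra_map X (\<phi> s)) d (coset g)
    = coset (free_algebra_map (\<Phi> d) g)"
proof -
  have "\<forall>g :: 'x word \<Rightarrow>\<^sub>0 'k. multi_power p (\<lambda>s. birack_algebra_map X (\<phi> s)) d (coset g)
      = coset (free_algebra_map (\<Phi> d) g)"
  proof (rule multi_power_induct2[where Q = "\<lambda>F h. \<forall>g. F (coset g) = coset (free_algebra_map h g)"],
      goal_cases)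
    case 1
    show ?case by (simp add: free_algebra_map_id)
  next
    case (2 s F h)
    have "birack_algebra_map X (\<phi> s) (coset g) = coset (free_algebra_map (\<phi> s) g)"
      for g :: "'x word \<Rightarrow>\<^sub>0 'k"
      unfolding birack_algebra_map_def
      using automorphism[OF 2(1)] unfolding graded_birack_automorphism_def
      by (intro relation_ideal.induced_map_coset free_algebra_map_add free_algebra_map_relation_ideal)
        auto
    with 2(2) show ?case
      by (simp add: free_algebra_map_comp)
  qed
  then show ?thesis ..
qed

text \<open>The components of a class are the classes of the homogeneous parts, so the Zhang product
  can be computed on representatives.\<close>

lemma zhang_mult_coset:
  fixes f g :: "'x word \<Rightarrow>\<^sub>0 'k::field"
  shows "zhang_mult p (birack_algebra X) (birack_algebra_grading p P X)
      (\<lambda>s. birack_algebra_map X (\<phi> s)) (coset f) (coset g) = coset (twisted_mult f g)"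
proof -
  let ?B = "birack_algebra X :: ('k, ('x word \<Rightarrow>\<^sub>0 'k) set) module"
  let ?c = "\<lambda>d. coset (homogeneous_part p P d f)"
  let ?S = "{d. ?c d \<noteq> \<zero>\<^bsub>?B\<^esub>}"
  let ?D = "degree ` Poly_Mapping.keys f"
  let ?F = "\<lambda>d. homogeneous_part p P d f * free_algebra_map (\<Phi> d) g"
  have zero: "\<zero>\<^bsub>?B\<^esub> = relation_ideal X"
    by (simp add: birack_algebra_def relation_ideal.zero_quotient relation_ideal.coset_zero)
  have "?c d \<otimes>\<^bsub>?B\<^esub> multi_power p (\<lambda>s. birack_algebra_map X (\<phi> s)) d (coset g) = coset (?F d)"
    for d
    by (simp add: multi_power_coset birack_algebra_def relation_ideal.mult_quotient)
  then have "zhang_mult p ?B (birack_algebra_grading p P X) (\<lambda>s. birack_algebra_map X (\<phi> s))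
      (coset f) (coset g) = (\<Oplus>\<^bsub>?B\<^esub>d\<in>?S. coset (?F d))"
    by (simp add: zhang_mult_def homogeneous_components_coset[OF graded])
  also have "\<dots> = coset (\<Sum>d\<in>?D. ?F d)"
  proof (rule relation_ideal.finsum_quotient_subset[folded birack_algebra_def])
    show "?S \<subseteq> ?D"
      using homogeneous_part_eq_0[of _ p P f] by (auto simp: zero relation_ideal.coset_zero)
    \<comment> \<open>For a degree outside \<open>?S\<close> the homogeneous part lies in the ideal,
      which absorbs the second factor.\<close>
    show "?F d \<in> relation_ideal X" if "d \<in> ?D - ?S" for d
      using that by (simp add: zero relation_ideal.coset_eq_ideal_iff relation_ideal.mult_mem)
  qed simp
  also have "(\<Sum>d\<in>?D. ?F d) = twisted_mult f g"
    unfolding twisted_mult_def by (rule sum_homogeneous_part_mult) auto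
  finally show ?thesis .
qed

theorem isotope_algebra_isomorphic_zhang_twist:
  "algebra_isomorphic
     (birack_algebra Y :: ('k::field, ('x word \<Rightarrow>\<^sub>0 'k) set) module)
     (zhang_twist p (birack_algebra X) (birack_algebra_grading p P X)
       (\<lambda>s. birack_algebra_map X (\<phi> s)))"
    (is "algebra_isomorphic ?A ?Z")
proof -
  have carrier: "carrier ?A = range (relation_ideal.coset Y)" "carrier ?Z = range coset"
    by (simp_all add: zhang_twist_def birack_algebra_def relation_ideal.carrier_quotient)
  have T_scale: "T (scale c f) = scale c (T f)" for c and f :: "'x word \<Rightarrow>\<^sub>0 'k"
    by (rule linear_extension_scale)
  have T_one: "T 1 = (1 :: 'x word \<Rightarrow>\<^sub>0 'k)"
    using extend_map_single[of twist 0 "1 :: 'k"] by (simp add: twist_zero)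
  \<comment> \<open>The isomorphism sends a coset to its image under \<open>T\<close>; being defined
    on sets, it involves no choice of representatives.\<close>
  have "image T \<in> ring_hom ?A ?Z"
  proof (rule ring_hom_memI; (unfold carrier)?)
    fix a b :: "('x word \<Rightarrow>\<^sub>0 'k) set"
    assume "a \<in> range (relation_ideal.coset Y)" "b \<in> range (relation_ideal.coset Y)"
    then obtain f g where ab: "a = relation_ideal.coset Y f" "b = relation_ideal.coset Y g"
      by blast
    show "T ` a \<in> range coset"
      by (simp add: ab T_coset)
    show "T ` (a \<otimes>\<^bsub>?A\<^esub> b) = T ` a \<otimes>\<^bsub>?Z\<^esub> T ` b"
      by (simp add: ab birack_algebra_def[of Y] relation_ideal.mult_quotient T_coset zhang_twist_def
          zhang_mult_coset T_mult)
    show "T ` (a \<oplus>\<^bsub>?A\<^esub> b) = T ` a \<oplus>\<^bsub>?Z\<^esub> T ` b"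
      by (simp add: ab birack_algebra_def relation_ideal.add_quotient T_coset zhang_twist_def
          linear_extension_add)
  next
    show "T ` \<one>\<^bsub>?A\<^esub> = \<one>\<^bsub>?Z\<^esub>"
      by (simp add: birack_algebra_def relation_ideal.one_quotient T_coset zhang_twist_def T_one)
  qed
  moreover have "bij_betw (image T) (carrier ?A) (carrier ?Z)"
    unfolding bij_betw_def
  proof
    show "inj_on (image T) (carrier ?A)"
      by (rule inj_onI) (simp add: inj_image_eq_iff[OF bij_is_inj[OF bij_T]])
    \<comment> \<open>Surjectivity of \<open>T\<close> lets every coset be written with a
      representative \<open>T f\<close>, so that \<open>T_coset\<close> applies.\<close>
    have "range (coset :: ('x word \<Rightarrow>\<^sub>0 'k) \<Rightarrow> _) = coset ` range T"
      by (simp add: bij_is_surj[OF bij_T])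
    then show "image T ` carrier ?A = carrier ?Z"
      by (simp add: carrier image_image T_coset)
  qed
  moreover have "T ` (c \<odot>\<^bsub>?A\<^esub> a) = c \<odot>\<^bsub>?Z\<^esub> T ` a" if a: "a \<in> carrier ?A" for c a
  proof -
    obtain f where "a = relation_ideal.coset Y f"
      using a carrier by blast
    then show ?thesis
      by (simp add: birack_algebra_def relation_ideal.smult_quotient T_coset zhang_twist_def T_scale)
  qed
  ultimately show ?thesis
    unfolding algebra_isomorphic_def ring_iso_def by blast
qed

end

theorem theorem3p2:
  fixes X :: "'x::finite birack_ops"
    and p :: nat
    and P :: "nat \<Rightarrow> 'x set"
    and \<phi> :: "nat \<Rightarrow> 'x \<Rightarrow> 'x"
  assumes "involutive_birack X"
    and "condition_lri X"
    and "graded_birack p P X"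
    and "\<forall>s\<in>{1..p}. graded_birack_automorphism p P X (\<phi> s)"
    and "\<forall>s\<in>{1..p}. \<forall>t\<in>{1..p}. \<phi> s \<circ> \<phi> t = \<phi> t \<circ> \<phi> s"
    and "\<forall>s\<in>{1..p}. \<forall>x. left_translation X (\<phi> s x) = left_translation X x"
  shows "algebra_isomorphic
           (birack_algebra (isotope p P \<phi> X) ::
             ('k::field_char_0, ('x word \<Rightarrow>\<^sub>0 'k) set) module)
           (zhang_twist p (birack_algebra X) (birack_algebra_grading p P X)
             (\<lambda>s. birack_algebra_map X (\<phi> s)))"
proof -
  interpret commuting_graded_automorphisms X p P \<phi>
    using assms
    by (simp add: commuting_graded_automorphisms_def commuting_graded_automorphisms_axioms_def)
  show ?thesis
    by (rule isotope_algebra_isomorphic_zhang_twist)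
qed

end
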